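(* If $f(z)=h(z)\overline{g(z)}\in\mathcal{B}_{Lh}$, then (i) $f^{a}\,\overline{f}^{\,b}\in\mathcal{B}_{Lh}$ for any $a,b\in\mathbb{C}$ (affine invariance); (ii) $f\circ\phi_\alpha\in\mathcal{B}_{Lh}$ for any $\alpha\in\mathbb{D}$ (linear invariance), where $\phi_\alpha(z)=\dfrac{z+\alpha}{1+\overline{\alpha}z}$, $z\in\mathbb{D}$.
   Context: $\mathbb{D}=\{z\in\mathbb{C}:|z|<1\}$. A log-harmonic mapping on $\mathbb{D}$ is a solution $f$ of $\overline{f_{\overline z}}/\overline{f}=\mu\, f_z/f$ for some analytic $\mu:\mathbb{D}\to\mathbb{C}$ with $|\mu(z)|<1$ on $\mathbb{D}$; $\mu$ is the (second complex) dilatation of $f$. A non-vanishing log-harmonic mapping can be written $f=h\overline{g}$ with $h,g$ analytic in $\mathbb{D}$. A non-vanishing log-harmonic mapping $f(z)=h(z)\overline{g(z)}$ in $\mathbb{D}$ is said to be a log-harmonic Bloch function if $$\beta(f)=\sup_{z\in\mathbb{D}}(1-|z|^2)\left(\left|\frac{h'(z)}{h(z)}\right|+\left|\frac{g'(z)}{g(z)}\right|\right)<+\infty ,$$ where $h$ and $g$ are analytic in $\mathbb{D}$, $h(z)=\exp\left(\sum_{n=0}^\infty a_nz^n\right)$ and $g(z)=\exp\left(\sum_{n=1}^\infty b_nz^n\right)$. $\mathcal{B}_{Lh}$ denotes the space of all log-harmonic Bloch functions. Complex powers are taken with the analytic branches $\log h=\sum_{n\ge0}a_nz^n$, $\log g=\sum_{n\ge1}b_nz^n$,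 so that $f^a\overline{f}^{\,b}=h^ag^b\,\overline{h^{\overline b}g^{\overline a}}$.
   Formalization: B_Lh is read without |μ|<1, since (i) fails with it: f=e^z, a=0, b=1 gives conj(e^z), not log-harmonic. For f log-harmonic with |μ|<1, that condition is also proved for f∘φ_α for all α, and for f^a conj(f)^b when |b|<|a| or a=b=0. *)

theory Defs
  imports "HOL-Complex_Analysis.Complex_Analysis"
begin

abbreviation unit_disc :: "complex set"
  where "unit_disc \<equiv> ball 0 1"

text \<open>
  Wirtinger derivatives, taken from the real Frechet derivative:
  the values at \<open>1\<close> and \<open>\<i>\<close> are the partial derivatives in the directions x and y.
\<close>

definition wirtinger_z :: "(complex \<Rightarrow> complex) \<Rightarrow> complex \<Rightarrow> complex"
  where "wirtinger_z f z =
    (frechet_derivative f (at z) 1 - \<i> * frechet_derivative f (at z) \<i>) / 2"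

definition wirtinger_zbar :: "(complex \<Rightarrow> complex) \<Rightarrow> complex \<Rightarrow> complex"
  where "wirtinger_zbar f z =
    (frechet_derivative f (at z) 1 + \<i> * frechet_derivative f (at z) \<i>) / 2"

text \<open>
  Differentiability is over the reals. Since \<open>f\<close> has no zeros, the quotients in the equation
  are genuine.
\<close>

definition nonvanishing_log_harmonic :: "(complex \<Rightarrow> complex) \<Rightarrow> bool"
  where "nonvanishing_log_harmonic f \<longleftrightarrow>
    (\<forall>z\<in>unit_disc. f differentiable (at z) \<and> f z \<noteq> 0) \<and>
    (\<exists>\<mu>. \<mu> holomorphic_on unit_disc \<and> (\<forall>z\<in>unit_disc. norm (\<mu> z) < 1) \<and>
      (\<forall>z\<in>unit_disc. cnj (wirtinger_zbar f z) / cnj (f z) = \<mu> z * (wirtinger_z f z / f z)))"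

text \<open>
  Functions on the disc are total functions on the complex plane of which only the values on
  \<open>unit_disc\<close> matter. The coefficient sequences \<open>p\<close> and \<open>q\<close> record the chosen branches of
  \<open>log h\<close> and \<open>log g\<close>; \<open>q 0 = 0\<close> says that the series of \<open>log g\<close> starts at index 1.
  Convergence of the series on the disc makes \<open>h\<close> and \<open>g\<close> analytic there.
\<close>

definition log_decomposition ::
  "(complex \<Rightarrow> complex) \<Rightarrow> (complex \<Rightarrow> complex) \<Rightarrow> (complex \<Rightarrow> complex) \<Rightarrow>
    (nat \<Rightarrow> complex) \<Rightarrow> (nat \<Rightarrow> complex) \<Rightarrow> bool"
  where "log_decomposition f h g p q \<longleftrightarrow> q 0 = 0 \<and>
    (\<forall>z\<in>unit_disc.
      summable (\<lambda>n. p n * z ^ n) \<and> h z = exp (\<Sum>n. p n * z ^ n) \<and>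
      summable (\<lambda>n. q n * z ^ n) \<and> g z = exp (\<Sum>n. q n * z ^ n) \<and>
      f z = h z * cnj (g z))"

definition bloch_beta :: "(complex \<Rightarrow> complex) \<Rightarrow> (complex \<Rightarrow> complex) \<Rightarrow> ereal"
  where "bloch_beta h g = (SUP z\<in>unit_disc.
    ereal ((1 - (norm z)\<^sup>2) * (norm (deriv h z / h z) + norm (deriv g z / g z))))"

text \<open>
  The Bloch space, without the condition that the dilatation has modulus less than 1. That
  condition is not preserved by \<open>f \<mapsto> f\<^sup>a (cnj f)\<^sup>b\<close> for arbitrary \<open>a\<close> and \<open>b\<close>: if \<open>f\<close> is
  non-constant with dilatation \<open>\<mu>\<close> and \<open>(a, b) \<noteq> (0, 0)\<close>, the power has dilatation \<open>(cnj b + cnj a * \<mu>) / (a + b * \<mu>)\<close>, which has modulus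
  less than 1 precisely when \<open>norm b < norm a\<close>. For instance, \<open>cnj (exp z)\<close> does not satisfy
  \<open>nonvanishing_log_harmonic\<close>, although \<open>exp z\<close> does. The narrower class is
  \<open>B_Lh \<inter> Collect nonvanishing_log_harmonic\<close>.
\<close>

definition B_Lh :: "(complex \<Rightarrow> complex) set"
  where "B_Lh = {f. \<exists>h g p q. log_decomposition f h g p q \<and> bloch_beta h g < \<infinity>}"

definition branch_power :: "(nat \<Rightarrow> complex) \<Rightarrow> complex \<Rightarrow> complex \<Rightarrow> complex"
  where "branch_power p a z = exp (a * (\<Sum>n. p n * z ^ n))"

text \<open>
  \<open>f\<^sup>a (cnj f)\<^sup>b = h\<^sup>a g\<^sup>b cnj (h\<^bsup>cnj b\<^esup> g\<^bsup>cnj a\<^esup>)\<close> for the branches of \<open>log h\<close> and \<open>log g\<close>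
  given by \<open>p\<close> and \<open>q\<close>.
\<close>

definition log_harmonic_power ::
  "(nat \<Rightarrow> complex) \<Rightarrow> (nat \<Rightarrow> complex) \<Rightarrow> complex \<Rightarrow> complex \<Rightarrow> complex \<Rightarrow> complex"
  where "log_harmonic_power p q a b z =
    branch_power p a z * branch_power q b z *
    cnj (branch_power p (cnj b) z * branch_power q (cnj a) z)"

definition disc_automorphism :: "complex \<Rightarrow> complex \<Rightarrow> complex"
  where "disc_automorphism \<alpha> z = (z + \<alpha>) / (1 + cnj \<alpha> * z)"

end

theory Submission
  imports Defs
begin

text \<open>
  A non-vanishing \<open>f = h * cnj g\<close> on the disc is \<open>exp (P + cnj Q)\<close> with \<open>P = log h\<close> and
  \<open>Q = log g\<close> holomorphic, and every notion involved can be read off from \<open>P'\<close> and \<open>Q'\<close>: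
  the Bloch condition bounds \<open>(1 - |z|\<^sup>2) (|P'| + |Q'|)\<close>, and a dilatation is a holomorphic \<open>\<mu>\<close>
  of modulus less than 1 with \<open>Q' = \<mu> P'\<close>.

  Two facts make this independent of choices. First, \<open>P'\<close> and \<open>cnj Q'\<close> are the logarithmic
  Wirtinger derivatives of \<open>f\<close> (lemma \<open>wirtinger_of_log_representation\<close>), so any
  representation of \<open>f\<close> has the same ones; this transfers the Bloch bound from the decomposition
  that membership in \<open>B_Lh\<close> provides to any other. Secondly, the normalisation
  \<open>log g = \<Sum>n\<ge>1. b\<^sub>n z\<^sup>n\<close> costs nothing, since \<open>Q 0\<close> can be moved into \<open>P\<close>
  (lemma \<open>B_Lh_iff_bloch_bound\<close>).

  With this, a power of \<open>f\<close> replaces \<open>(P, Q)\<close> by \<open>(a P + b Q, cnj b P + cnj a Q)\<close>,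
  so the derivatives change by a bounded linear map, and the dilatation by the Moebius
  map \<open>\<mu> \<mapsto> (cnj b + cnj a * \<mu>) / (a + b * \<mu>)\<close>, which preserves the disc when \<open>|b| < |a|\<close>.
  Composition with a disc automorphism \<open>\<phi>\<close> multiplies \<open>P'\<close> and \<open>Q'\<close> by \<open>\<phi>'\<close>, and
  \<open>(1 - |z|\<^sup>2) |\<phi>'(z)| = 1 - |\<phi>(z)|\<^sup>2\<close>, so the Bloch bound is unchanged; the dilatation
  becomes \<open>\<mu> \<circ> \<phi>\<close>. Both Moebius computations are the single identity
  \<open>norm_moebius_identity\<close>.
\<close>

section \<open>Logarithmic representations\<close>

text \<open>
  The value \<open>Q 0\<close> is left free, so that composition with a disc automorphism, which moves the
  origin, gives a representation again.
\<close>

definition log_representation ::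
  "(complex \<Rightarrow> complex) \<Rightarrow> (complex \<Rightarrow> complex) \<Rightarrow> (complex \<Rightarrow> complex) \<Rightarrow> bool"
  where "log_representation f P Q \<longleftrightarrow> P holomorphic_on unit_disc \<and> Q holomorphic_on unit_disc \<and>
    (\<forall>z\<in>unit_disc. f z = exp (P z + cnj (Q z)))"

lemma holomorphic_on_unit_disc_has_deriv:
  assumes "P holomorphic_on unit_disc" "z \<in> unit_disc"
  shows "(P has_field_derivative deriv P z) (at z)"
  using assms holomorphic_derivI open_ball by blast

text \<open>
  The real derivative of \<open>exp (P + cnj Q)\<close> in the direction \<open>v\<close> is \<open>f z * (P' v + cnj (Q' v))\<close>,
  whose complex-linear and antilinear parts are the two Wirtinger derivatives.
\<close>

lemma wirtinger_of_log_representation: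
  assumes rep: "log_representation f P Q" and z: "z \<in> unit_disc"
  shows "f differentiable (at z)"
    and "wirtinger_z f z = f z * deriv P z"
    and "wirtinger_zbar f z = f z * cnj (deriv Q z)"
proof -
  have P: "(P has_derivative (\<lambda>v. deriv P z * v)) (at z)"
    and Q: "(Q has_derivative (\<lambda>v. deriv Q z * v)) (at z)"
    using rep z holomorphic_on_unit_disc_has_deriv
    by (auto simp: log_representation_def intro!: has_field_derivative_imp_has_derivative)
  have "((\<lambda>w. P w + cnj (Q w)) has_derivative (\<lambda>v. deriv P z * v + cnj (deriv Q z * v))) (at z)"
    by (intro has_derivative_add P has_derivative_cnj Q)
  then have "((\<lambda>w. exp (P w + cnj (Q w))) has_derivative
      (\<lambda>v. exp (P z + cnj (Q z)) * (deriv P z * v + cnj (deriv Q z * v)))) (at z)"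
    by (rule has_derivative_compose
        [OF _ has_field_derivative_imp_has_derivative[OF DERIV_exp]])
  then have D: "(f has_derivative
      (\<lambda>v. exp (P z + cnj (Q z)) * (deriv P z * v + cnj (deriv Q z * v)))) (at z)"
    by (rule has_derivative_transform_within_open[OF _ open_ball[of 0 1]])
      (use rep z in \<open>auto simp: log_representation_def\<close>)
  then show "f differentiable (at z)"
    by (rule differentiableI)
  have fr: "frechet_derivative f (at z) =
      (\<lambda>v. f z * (deriv P z * v + cnj (deriv Q z * v)))"
    using frechet_derivative_at[OF D] rep z by (simp add: log_representation_def)
  show "wirtinger_z f z = f z * deriv P z" "wirtinger_zbar f z = f z * cnj (deriv Q z)"
    by (simp_all add: wirtinger_z_def wirtinger_zbar_def fr algebra_simps)
qed

lemma log_representation_nonzero: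
  "log_representation f P Q \<Longrightarrow> z \<in> unit_disc \<Longrightarrow> f z \<noteq> 0"
  by (simp add: log_representation_def)

text \<open>
  The logarithms themselves are determined only up to constants, but \<open>P'\<close> and
  \<open>cnj Q'\<close> are the quotients of the Wirtinger derivatives of \<open>f\<close> by \<open>f\<close>.
\<close>

lemma log_representation_deriv_unique:
  assumes "log_representation f P Q" "log_representation f P' Q'" "z \<in> unit_disc"
  shows "deriv P z = deriv P' z" "deriv Q z = deriv Q' z"
proof -
  have "f z \<noteq> 0"
    using assms log_representation_nonzero by blast
  then show "deriv P z = deriv P' z" "deriv Q z = deriv Q' z"
    using wirtinger_of_log_representation(2,3)[OF assms(1,3)]
      wirtinger_of_log_representation(2,3)[OF assms(2,3)] by auto
qed

section \<open>The dilatation and the Bloch condition in terms of the logarithms\<close>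

definition has_dilatation ::
  "(complex \<Rightarrow> complex) \<Rightarrow> (complex \<Rightarrow> complex) \<Rightarrow> (complex \<Rightarrow> complex) \<Rightarrow> bool"
  where "has_dilatation P Q \<mu> \<longleftrightarrow> \<mu> holomorphic_on unit_disc \<and>
    (\<forall>z\<in>unit_disc. norm (\<mu> z) < 1 \<and> deriv Q z = \<mu> z * deriv P z)"

lemma nonvanishing_log_harmonic_iff_dilatation:
  assumes "log_representation f P Q"
  shows "nonvanishing_log_harmonic f \<longleftrightarrow> (\<exists>\<mu>. has_dilatation P Q \<mu>)"
proof -
  have "cnj (wirtinger_zbar f z) / cnj (f z) = deriv Q z" "wirtinger_z f z / f z = deriv P z"
    if "z \<in> unit_disc" for z
    using wirtinger_of_log_representation[OF assms that] log_representation_nonzero[OF assms that]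
    by auto
  moreover have "\<forall>z\<in>unit_disc. f differentiable (at z) \<and> f z \<noteq> 0"
    using wirtinger_of_log_representation(1)[OF assms] log_representation_nonzero[OF assms] by blast
  ultimately show ?thesis
    unfolding nonvanishing_log_harmonic_def has_dilatation_def by (simp add: ball_conj_distrib)
qed

definition bloch_bound :: "(complex \<Rightarrow> complex) \<Rightarrow> (complex \<Rightarrow> complex) \<Rightarrow> real \<Rightarrow> bool"
  where "bloch_bound P Q M \<longleftrightarrow>
    (\<forall>z\<in>unit_disc. (1 - (norm z)\<^sup>2) * (norm (deriv P z) + norm (deriv Q z)) \<le> M)"

lemma power_series_holomorphic_on_unit_disc:
  fixes p :: "nat \<Rightarrow> complex"
  assumes "\<forall>z\<in>unit_disc. summable (\<lambda>n. p n * z ^ n)"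
  shows "(\<lambda>z. \<Sum>n. p n * z ^ n) holomorphic_on unit_disc"
  using assms by (intro power_series_holomorphic[where a = p]) (auto intro: summable_sums)

lemma log_decomposition_imp_log_representation:
  assumes "log_decomposition f h g p q"
  shows "log_representation f (\<lambda>z. \<Sum>n. p n * z ^ n) (\<lambda>z. \<Sum>n. q n * z ^ n)"
  using assms unfolding log_decomposition_def log_representation_def
  by (auto intro!: power_series_holomorphic_on_unit_disc simp: exp_add exp_cnj)

lemma log_deriv_exp_on_unit_disc:
  assumes "P holomorphic_on unit_disc" "\<forall>z\<in>unit_disc. h z = exp (P z)" "z \<in> unit_disc"
  shows "deriv h z / h z = deriv P z"
proof -
  have "((\<lambda>w. exp (P w)) has_field_derivative exp (P z) * deriv P z) (at z)"
    using holomorphic_on_unit_disc_has_deriv[OF assms(1,3)] by (rule DERIV_fun_exp)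
  then have "(h has_field_derivative exp (P z) * deriv P z) (at z)"
    by (rule has_field_derivative_transform_within_open[OF _ open_ball[of 0 1]])
      (use assms(2,3) in auto)
  then show ?thesis
    using assms(2,3) by (simp add: DERIV_imp_deriv)
qed

lemma bloch_beta_finite_iff:
  assumes P: "P holomorphic_on unit_disc" "\<forall>z\<in>unit_disc. h z = exp (P z)"
    and Q: "Q holomorphic_on unit_disc" "\<forall>z\<in>unit_disc. g z = exp (Q z)"
  shows "bloch_beta h g < \<infinity> \<longleftrightarrow> (\<exists>M. bloch_bound P Q M)"
proof -
  define b where "b z = (1 - (norm z)\<^sup>2) * (norm (deriv P z) + norm (deriv Q z))" for z
  have beta: "bloch_beta h g = (SUP z\<in>unit_disc. ereal (b z))"
    unfolding bloch_beta_def b_def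
    by (intro SUP_cong refl)
      (simp add: log_deriv_exp_on_unit_disc[OF P] log_deriv_exp_on_unit_disc[OF Q])
  have "(SUP z\<in>unit_disc. ereal (b z)) < \<infinity> \<longleftrightarrow> (\<exists>M. \<forall>z\<in>unit_disc. b z \<le> M)"
  proof
    assume "(SUP z\<in>unit_disc. ereal (b z)) < \<infinity>"
    then obtain M where "(SUP z\<in>unit_disc. ereal (b z)) < ereal M"
      using less_PInf_Ex_of_nat by force
    then show "\<exists>M. \<forall>z\<in>unit_disc. b z \<le> M"
      by (metis SUP_lessD ereal_less_eq(3) less_imp_le)
  next
    assume "\<exists>M. \<forall>z\<in>unit_disc. b z \<le> M"
    then obtain M where "(SUP z\<in>unit_disc. ereal (b z)) \<le> ereal M"
      by (metis SUP_least ereal_less_eq(3))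
    then show "(SUP z\<in>unit_disc. ereal (b z)) < \<infinity>"
      using le_less_trans by fastforce
  qed
  then show ?thesis
    by (simp add: beta b_def bloch_bound_def)
qed

lemma holomorphic_on_unit_disc_power_series:
  assumes "P holomorphic_on unit_disc"
  obtains p where "\<forall>z\<in>unit_disc. (\<lambda>n. p n * z ^ n) sums P z"
proof
  show "\<forall>z\<in>unit_disc. (\<lambda>n. (deriv ^^ n) P 0 / fact n * z ^ n) sums P z"
    using holomorphic_power_series[OF assms] by simp
qed

text \<open>
  For one direction the derivatives are transferred between representations by uniqueness. For
  the other, replacing \<open>(P, Q)\<close> by \<open>(P + cnj (Q 0), Q - Q 0)\<close> leaves \<open>f\<close> and both
  derivatives alone and gives the second power series a vanishing constant term.
\<close>

lemma B_Lh_iff_bloch_bound: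
  assumes rep: "log_representation f P Q"
  shows "f \<in> B_Lh \<longleftrightarrow> (\<exists>M. bloch_bound P Q M)"
proof
  assume "f \<in> B_Lh"
  then obtain h g p q where dec: "log_decomposition f h g p q" and fin: "bloch_beta h g < \<infinity>"
    by (auto simp: B_Lh_def)
  define P' Q' where "P' = (\<lambda>z. \<Sum>n. p n * z ^ n)" and "Q' = (\<lambda>z. \<Sum>n. q n * z ^ n)"
  have rep': "log_representation f P' Q'"
    using dec unfolding P'_def Q'_def by (rule log_decomposition_imp_log_representation)
  have "\<forall>z\<in>unit_disc. h z = exp (P' z)" "\<forall>z\<in>unit_disc. g z = exp (Q' z)"
    using dec by (auto simp: log_decomposition_def P'_def Q'_def)
  then obtain M where "bloch_bound P' Q' M"
    using fin rep' bloch_beta_finite_iff[of P' h Q' g] by (auto simp: log_representation_def)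
  then show "\<exists>M. bloch_bound P Q M"
    using log_representation_deriv_unique[OF rep rep'] by (auto simp: bloch_bound_def)
next
  assume "\<exists>M. bloch_bound P Q M"
  then obtain M where M: "bloch_bound P Q M" ..
  define P' Q' where "P' = (\<lambda>z. P z + cnj (Q 0))" and "Q' = (\<lambda>z. Q z - Q 0)"
  have hol: "P' holomorphic_on unit_disc" "Q' holomorphic_on unit_disc"
    using rep by (auto simp: log_representation_def P'_def Q'_def intro!: holomorphic_intros)
  have rep': "log_representation f P' Q'"
    using rep hol by (simp add: log_representation_def P'_def Q'_def)
  obtain p where p: "\<forall>z\<in>unit_disc. (\<lambda>n. p n * z ^ n) sums P' z"
    using holomorphic_on_unit_disc_power_series[OF hol(1)] .
  obtain q where q: "\<forall>z\<in>unit_disc. (\<lambda>n. q n * z ^ n) sums Q' z"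
    using holomorphic_on_unit_disc_power_series[OF hol(2)] .
  have "q 0 = Q' 0"
    using q by (metis centre_in_ball powser_sums_zero_iff zero_less_one)
  then have "q 0 = 0"
    by (simp add: Q'_def)
  then have "log_decomposition f (\<lambda>z. exp (P' z)) (\<lambda>z. exp (Q' z)) p q"
    using p q rep'
    by (auto simp: log_decomposition_def log_representation_def sums_iff exp_add exp_cnj)
  moreover have "bloch_bound P' Q' M"
    using M log_representation_deriv_unique[OF rep rep'] by (simp add: bloch_bound_def)
  then have "bloch_beta (\<lambda>z. exp (P' z)) (\<lambda>z. exp (Q' z)) < \<infinity>"
    by (subst bloch_beta_finite_iff[of P' _ Q']) (use hol in auto)
  ultimately show "f \<in> B_Lh"
    by (auto simp: B_Lh_def)
qed

section \<open>Moebius maps of the disc\<close>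

text \<open>
  The cross terms agree because \<open>Re (a * cnj (b * w)) = Re (cnj b * cnj (cnj a * w))\<close>. The case
  \<open>a = 1\<close>, \<open>b = cnj \<alpha>\<close> compares numerator and denominator of a disc automorphism; the general
  case does so for the dilatation of a power.
\<close>

lemma norm_moebius_identity:
  "(norm (a + b * w))\<^sup>2 - (norm (cnj b + cnj a * w))\<^sup>2 =
    ((norm a)\<^sup>2 - (norm b)\<^sup>2) * (1 - (norm w)\<^sup>2)" for a b w :: complex
  unfolding cmod_power2 by (simp add: power2_eq_square algebra_simps)

lemma norm_moebius_less:
  fixes a b w :: complex
  assumes "norm b < norm a" "norm w < 1"
  shows "norm (cnj b + cnj a * w) < norm (a + b * w)"
proof -
  have "(norm b)\<^sup>2 < (norm a)\<^sup>2" "(norm w)\<^sup>2 < 1"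
    using assms by (auto simp: power_strict_mono abs_square_less_1)
  then have "0 < (norm (a + b * w))\<^sup>2 - (norm (cnj b + cnj a * w))\<^sup>2"
    unfolding norm_moebius_identity by simp
  then show ?thesis
    by (simp add: power2_less_imp_less)
qed

context
  fixes \<alpha> z :: complex
  assumes \<alpha>: "\<alpha> \<in> unit_disc" and z: "z \<in> unit_disc"
begin

lemma disc_automorphism_denominator:
  "norm (z + \<alpha>) < norm (1 + cnj \<alpha> * z)" "1 + cnj \<alpha> * z \<noteq> 0"
proof -
  show less: "norm (z + \<alpha>) < norm (1 + cnj \<alpha> * z)"
    using norm_moebius_less[of "cnj \<alpha>" 1 z] \<alpha> z by (simp add: add.commute)
  then show "1 + cnj \<alpha> * z \<noteq> 0"
    by auto
qed

lemma disc_automorphism_in_unit_disc: "disc_automorphism \<alpha> z \<in> unit_disc"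
  using disc_automorphism_denominator by (simp add: disc_automorphism_def norm_divide)

lemma has_field_derivative_disc_automorphism:
  "(disc_automorphism \<alpha> has_field_derivative
    of_real (1 - (norm \<alpha>)\<^sup>2) / (1 + cnj \<alpha> * z)\<^sup>2) (at z)"
proof -
  have "of_real (1 - (norm \<alpha>)\<^sup>2) = 1 - \<alpha> * cnj \<alpha>"
    by (simp only: of_real_diff of_real_1 complex_norm_square)
  then show ?thesis
    unfolding disc_automorphism_def using disc_automorphism_denominator(2)
    by (auto intro!: derivative_eq_intros simp: power2_eq_square algebra_simps
        simp del: of_real_diff)
qed

text \<open>
  Equality in the Schwarz-Pick lemma: the numerator \<open>|1 + cnj \<alpha> * z|\<^sup>2 - |z + \<alpha>|\<^sup>2\<close> of the right-hand
  side factors by \<open>norm_moebius_identity\<close>, and one factor is the numerator of the derivative.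
\<close>

lemma norm_deriv_disc_automorphism:
  "(1 - (norm z)\<^sup>2) * norm (deriv (disc_automorphism \<alpha>) z) = 1 - (norm (disc_automorphism \<alpha> z))\<^sup>2"
proof -
  have "(norm \<alpha>)\<^sup>2 < 1"
    using \<alpha> by (simp add: abs_square_less_1)
  then have "norm (deriv (disc_automorphism \<alpha>) z) =
      (1 - (norm \<alpha>)\<^sup>2) / (norm (1 + cnj \<alpha> * z))\<^sup>2"
    unfolding DERIV_imp_deriv[OF has_field_derivative_disc_automorphism] norm_divide norm_power
      norm_of_real by simp
  moreover have "(norm (1 + cnj \<alpha> * z))\<^sup>2 - (norm (z + \<alpha>))\<^sup>2 =
      (1 - (norm \<alpha>)\<^sup>2) * (1 - (norm z)\<^sup>2)"
    using norm_moebius_identity[of 1 "cnj \<alpha>" z] by (simp add: add.commute)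
  moreover have "norm (1 + cnj \<alpha> * z) \<noteq> 0"
    using disc_automorphism_denominator(2) by simp
  moreover have "1 - (norm (z + \<alpha>))\<^sup>2 / N\<^sup>2 = (N\<^sup>2 - (norm (z + \<alpha>))\<^sup>2) / N\<^sup>2"
    if "N \<noteq> 0" for N :: real
    using that by (simp add: diff_divide_distrib)
  ultimately show ?thesis
    by (simp add: disc_automorphism_def norm_divide power_divide mult.commute)
qed

end

lemma holomorphic_disc_automorphism:
  "\<alpha> \<in> unit_disc \<Longrightarrow> disc_automorphism \<alpha> holomorphic_on unit_disc"
  unfolding holomorphic_on_open[OF open_ball]
  using has_field_derivative_disc_automorphism by blast

section \<open>Affine invariance\<close>

lemma log_representation_log_harmonic_power:
  assumes P: "P = (\<lambda>z. \<Sum>n. p n * z ^ n)" "P holomorphic_on unit_disc"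
    and Q: "Q = (\<lambda>z. \<Sum>n. q n * z ^ n)" "Q holomorphic_on unit_disc"
  shows "log_representation (log_harmonic_power p q a b)
    (\<lambda>z. a * P z + b * Q z) (\<lambda>z. cnj b * P z + cnj a * Q z)"
  using P(2) Q(2)
  by (auto simp: log_representation_def log_harmonic_power_def branch_power_def exp_add
      exp_cnj P(1)[symmetric, THEN fun_cong] Q(1)[symmetric, THEN fun_cong]
      intro!: holomorphic_intros)

lemma deriv_linear_combination:
  assumes "P holomorphic_on unit_disc" "Q holomorphic_on unit_disc" "z \<in> unit_disc"
  shows "deriv (\<lambda>z. a * P z + b * Q z) z = a * deriv P z + b * deriv Q z"
  using assms
  by (intro DERIV_imp_deriv DERIV_add DERIV_cmult holomorphic_on_unit_disc_has_deriv)

lemma bloch_bound_linear_combination: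
  assumes hol: "P holomorphic_on unit_disc" "Q holomorphic_on unit_disc" and M: "bloch_bound P Q M"
  shows "bloch_bound (\<lambda>z. a * P z + b * Q z) (\<lambda>z. cnj b * P z + cnj a * Q z)
    ((norm a + norm b) * M)"
  unfolding bloch_bound_def
proof
  fix z assume z: "z \<in> unit_disc"
  have "norm (a * deriv P z + b * deriv Q z) + norm (cnj b * deriv P z + cnj a * deriv Q z)
      \<le> (norm a * norm (deriv P z) + norm b * norm (deriv Q z)) +
        (norm b * norm (deriv P z) + norm a * norm (deriv Q z))"
    by (intro add_mono norm_triangle_le) (simp_all add: norm_mult)
  also have "\<dots> = (norm a + norm b) * (norm (deriv P z) + norm (deriv Q z))"
    by (simp add: algebra_simps)
  finally have "(1 - (norm z)\<^sup>2) * (norm (a * deriv P z + b * deriv Q z) +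
      norm (cnj b * deriv P z + cnj a * deriv Q z))
    \<le> (1 - (norm z)\<^sup>2) * ((norm a + norm b) * (norm (deriv P z) + norm (deriv Q z)))"
    using z by (intro mult_left_mono) (auto simp: abs_square_le_1)
  also have "\<dots> = (norm a + norm b) * ((1 - (norm z)\<^sup>2) * (norm (deriv P z) + norm (deriv Q z)))"
    by (simp add: mult_ac)
  also have "\<dots> \<le> (norm a + norm b) * M"
    using M z by (intro mult_left_mono) (auto simp: bloch_bound_def)
  finally show "(1 - (norm z)\<^sup>2) * (norm (deriv (\<lambda>z. a * P z + b * Q z) z) +
      norm (deriv (\<lambda>z. cnj b * P z + cnj a * Q z) z)) \<le> (norm a + norm b) * M"
    by (simp only: deriv_linear_combination[OF hol z])
qed

lemma has_dilatation_linear_combination: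
  assumes hol: "P holomorphic_on unit_disc" "Q holomorphic_on unit_disc"
    and \<mu>: "has_dilatation P Q \<mu>" and ab: "norm b < norm a"
  shows "has_dilatation (\<lambda>z. a * P z + b * Q z) (\<lambda>z. cnj b * P z + cnj a * Q z)
    (\<lambda>z. (cnj b + cnj a * \<mu> z) / (a + b * \<mu> z))"
proof -
  have less: "norm (cnj b + cnj a * \<mu> z) < norm (a + b * \<mu> z)" and nz: "a + b * \<mu> z \<noteq> 0"
    if "z \<in> unit_disc" for z
  proof -
    show "norm (cnj b + cnj a * \<mu> z) < norm (a + b * \<mu> z)"
      using norm_moebius_less ab \<mu> that by (auto simp: has_dilatation_def)
    then show "a + b * \<mu> z \<noteq> 0"
      by auto
  qed
  have "(\<lambda>z. (cnj b + cnj a * \<mu> z) / (a + b * \<mu> z)) holomorphic_on unit_disc"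
    using \<mu> nz by (auto simp: has_dilatation_def intro!: holomorphic_intros)
  moreover have "norm ((cnj b + cnj a * \<mu> z) / (a + b * \<mu> z)) < 1" if "z \<in> unit_disc" for z
    using less[OF that] nz[OF that] by (simp add: norm_divide)
  moreover have "cnj b * deriv P z + cnj a * deriv Q z =
      (cnj b + cnj a * \<mu> z) / (a + b * \<mu> z) * (a * deriv P z + b * deriv Q z)"
    if "z \<in> unit_disc" for z
  proof -
    have "deriv Q z = \<mu> z * deriv P z"
      using \<mu> that by (auto simp: has_dilatation_def)
    moreover have "a * deriv P z + b * (\<mu> z * deriv P z) = (a + b * \<mu> z) * deriv P z"
      "cnj b * deriv P z + cnj a * (\<mu> z * deriv P z) = (cnj b + cnj a * \<mu> z) * deriv P z"
      by (simp_all add: algebra_simps)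
    ultimately show ?thesis
      using nz[OF that] by simp
  qed
  ultimately show ?thesis
    unfolding has_dilatation_def
    by (simp add: deriv_linear_combination[OF hol] del: mem_ball mem_ball_0)
qed

section \<open>Linear invariance\<close>

lemma log_representation_compose_disc_automorphism:
  assumes "log_representation f P Q" "\<alpha> \<in> unit_disc"
  shows "log_representation (f \<circ> disc_automorphism \<alpha>)
    (P \<circ> disc_automorphism \<alpha>) (Q \<circ> disc_automorphism \<alpha>)"
  using assms holomorphic_disc_automorphism disc_automorphism_in_unit_disc[OF assms(2)]
  by (auto simp: log_representation_def simp del: mem_ball mem_ball_0
      intro!: holomorphic_on_compose_gen[of _ unit_disc _ unit_disc])

lemma deriv_compose_disc_automorphism:
  assumes "P holomorphic_on unit_disc" "\<alpha> \<in> unit_disc" "z \<in> unit_disc"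
  shows "deriv (P \<circ> disc_automorphism \<alpha>) z =
    deriv P (disc_automorphism \<alpha> z) * deriv (disc_automorphism \<alpha>) z"
  using assms disc_automorphism_in_unit_disc holomorphic_disc_automorphism
  by (intro deriv_chain)
    (auto simp del: mem_ball mem_ball_0 intro: holomorphic_on_imp_differentiable_at[OF _ open_ball])

lemma bloch_bound_compose_disc_automorphism:
  assumes "P holomorphic_on unit_disc" "Q holomorphic_on unit_disc" "\<alpha> \<in> unit_disc"
    and M: "bloch_bound P Q M"
  shows "bloch_bound (P \<circ> disc_automorphism \<alpha>) (Q \<circ> disc_automorphism \<alpha>) M"
  unfolding bloch_bound_def
proof
  fix z assume z: "z \<in> unit_disc"
  let ?\<phi> = "disc_automorphism \<alpha>"
  have "(1 - (norm z)\<^sup>2) * (norm (deriv (P \<circ> ?\<phi>) z) + norm (deriv (Q \<circ> ?\<phi>) z)) =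
      ((1 - (norm z)\<^sup>2) * norm (deriv ?\<phi> z)) * (norm (deriv P (?\<phi> z)) + norm (deriv Q (?\<phi> z)))"
    using assms z by (simp add: deriv_compose_disc_automorphism norm_mult algebra_simps
        del: mem_ball mem_ball_0)
  also have "\<dots> \<le> M"
    unfolding norm_deriv_disc_automorphism[OF assms(3) z]
    using M disc_automorphism_in_unit_disc[OF assms(3) z] unfolding bloch_bound_def by blast
  finally show "(1 - (norm z)\<^sup>2) * (norm (deriv (P \<circ> ?\<phi>) z) + norm (deriv (Q \<circ> ?\<phi>) z)) \<le> M" .
qed

lemma has_dilatation_compose_disc_automorphism:
  assumes hol: "P holomorphic_on unit_disc" "Q holomorphic_on unit_disc"
    and \<alpha>: "\<alpha> \<in> unit_disc" and \<mu>: "has_dilatation P Q \<mu>"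
  shows "has_dilatation (P \<circ> disc_automorphism \<alpha>) (Q \<circ> disc_automorphism \<alpha>)
    (\<mu> \<circ> disc_automorphism \<alpha>)"
  unfolding has_dilatation_def
  using \<mu> holomorphic_disc_automorphism[OF \<alpha>] disc_automorphism_in_unit_disc[OF \<alpha>]
  by (auto simp: has_dilatation_def deriv_compose_disc_automorphism hol \<alpha>
      simp del: mem_ball mem_ball_0
      intro!: holomorphic_on_compose_gen[of _ unit_disc _ unit_disc])

section \<open>Affine and linear invariance of the Bloch space\<close>

theorem proposition6p1:
  fixes f h g :: "complex \<Rightarrow> complex" and p q :: "nat \<Rightarrow> complex"
  assumes "f \<in> B_Lh" and "log_decomposition f h g p q"
  shows "(\<forall>a b. log_harmonic_power p q a b \<in> B_Lh) \<and>
    (\<forall>\<alpha>\<in>unit_disc. f \<circ> disc_automorphism \<alpha> \<in> B_Lh) \<and>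
    (nonvanishing_log_harmonic f \<longrightarrow>
      (\<forall>a b. norm b < norm a \<or> a = 0 \<and> b = 0 \<longrightarrow>
        nonvanishing_log_harmonic (log_harmonic_power p q a b)) \<and>
      (\<forall>\<alpha>\<in>unit_disc. nonvanishing_log_harmonic (f \<circ> disc_automorphism \<alpha>)))"
proof -
  define P Q where "P = (\<lambda>z. \<Sum>n. p n * z ^ n)" and "Q = (\<lambda>z. \<Sum>n. q n * z ^ n)"
  have rep: "log_representation f P Q"
    using assms(2) unfolding P_def Q_def by (rule log_decomposition_imp_log_representation)
  then have hol: "P holomorphic_on unit_disc" "Q holomorphic_on unit_disc"
    by (auto simp: log_representation_def)
  have rep_power: "log_representation (log_harmonic_power p q a b)
      (\<lambda>z. a * P z + b * Q z) (\<lambda>z. cnj b * P z + cnj a * Q z)" for a b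
    using P_def hol(1) Q_def hol(2) by (rule log_representation_log_harmonic_power)
  note rep_comp = log_representation_compose_disc_automorphism[OF rep]
  obtain M where M: "bloch_bound P Q M"
    using assms(1) B_Lh_iff_bloch_bound[OF rep] by blast
  have "log_harmonic_power p q a b \<in> B_Lh" for a b
    using B_Lh_iff_bloch_bound[OF rep_power] bloch_bound_linear_combination[OF hol M] by blast
  moreover have "f \<circ> disc_automorphism \<alpha> \<in> B_Lh" if "\<alpha> \<in> unit_disc" for \<alpha>
    using B_Lh_iff_bloch_bound[OF rep_comp[OF that]]
      bloch_bound_compose_disc_automorphism[OF hol that M] by blast
  moreover have "nonvanishing_log_harmonic (log_harmonic_power p q a b)"
    if harm: "nonvanishing_log_harmonic f" and ab: "norm b < norm a \<or> a = 0 \<and> b = 0" for a b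
  proof -
    obtain \<mu> where \<mu>: "has_dilatation P Q \<mu>"
      using harm nonvanishing_log_harmonic_iff_dilatation[OF rep] by blast
    have "\<exists>\<nu>. has_dilatation (\<lambda>z. a * P z + b * Q z) (\<lambda>z. cnj b * P z + cnj a * Q z) \<nu>"
      using ab
    proof
      assume "norm b < norm a"
      then show ?thesis
        using has_dilatation_linear_combination[OF hol \<mu>] by blast
    next
      assume "a = 0 \<and> b = 0"
      \<comment> \<open>the power is the constant 1, and \<open>(cnj b + cnj a * \<mu>) / (a + b * \<mu>)\<close> degenerates\<close>
      then have "has_dilatation (\<lambda>z. a * P z + b * Q z) (\<lambda>z. cnj b * P z + cnj a * Q z) (\<lambda>_. 0)"
        by (simp add: has_dilatation_def)
      then show ?thesis
        by blast
    qed
    then show ?thesis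
      using nonvanishing_log_harmonic_iff_dilatation[OF rep_power] by blast
  qed
  moreover have "nonvanishing_log_harmonic (f \<circ> disc_automorphism \<alpha>)"
    if "nonvanishing_log_harmonic f" "\<alpha> \<in> unit_disc" for \<alpha>
    using that(1) nonvanishing_log_harmonic_iff_dilatation[OF rep]
      nonvanishing_log_harmonic_iff_dilatation[OF rep_comp[OF that(2)]]
      has_dilatation_compose_disc_automorphism[OF hol that(2)] by blast
  ultimately show ?thesis
    by blast
qed

end
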